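(* Let $f:\mathbb{R}\to\mathbb{R}$ be a function. The following two statements are equivalent: (1) $f$ is bilaterally $\mathbb{Q}$-continuous. (2) For every $x<y$ there exists a continuous function $G_{x,y}:\mathbb{R}\to\mathbb{R}$ such that $G_{x,y}(t)=f(t)$ for all $t\in L(x,y)$. Similarly, the following two statements are equivalent: (3) $f$ is $\mathbb{Q}$-continuous. (4) There exists a family of functions $\{G_{x,y}\}_{x<y,\ x,y\in\mathbb{R}}$, $G_{x,y}:\mathbb{R}\to\mathbb{R}$, such that (i) $G_{x,y}(t)=f(t)$ for all $x<y$ and all $t\in L(x,y)$; (ii) for all $x<y$, the set of discontinuities of $G_{x,y}$ contains no points of $L(x,y)$; (iii) the set of points $z\in\mathbb{R}$ such that some $G_{x,y}$ is discontinuous at $z$ has no accumulation points in $\mathbb{R}$ (that is, it is discrete and closed).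
   Context: Continuity and accumulation points refer to the usual topology of $\mathbb{R}$. For real $x\neq y$ put $L(x,y)=\{qx+(1-q)y: q\in\mathbb{Q}\}$ and $S(x,y)=\{qx+(1-q)y: q\in\mathbb{Q}\cap[0,1]\}$. $f:\mathbb{R}\to\mathbb{R}$ is $\mathbb{Q}$-continuous at $x$ from the left if there is $\epsilon>0$ such that for all $y,z$ with $x-\epsilon<y<z\le x$ there is a continuous function $f_{y,z}:[y,z]\to\mathbb{R}$ with $f_{y,z}(t)=f(t)$ for all $t\in S(y,z)$; $\mathbb{Q}$-continuity at $x$ from the right is defined analogously with $x\le y<z<x+\epsilon$. $f$ is $\mathbb{Q}$-continuous at $x$ if it is so from both sides, and $\mathbb{Q}$-continuous if it is $\mathbb{Q}$-continuous at every $x\in\mathbb{R}$. $f$ is bilaterally $\mathbb{Q}$-continuous at $x$ if there is $\epsilon>0$ such that for all $y,z$ with $x-\epsilon\le y<z\le x+\epsilon$ there is a continuous function $f_{y,z}:[y,z]\to\mathbb{R}$ with $f_{y,z}(t)=f(t)$ for all $t\in S(y,z)$. $f$ is bilaterally $\mathbb{Q}$-continuous if this holds at every $x\in\mathbb{R}$. *)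

theory Defs
  imports "HOL-Analysis.Analysis"
begin

definition Qline :: "real \<Rightarrow> real \<Rightarrow> real set" where
  "Qline x y = {q * x + (1 - q) * y | q. q \<in> \<rat>}"

definition Qsegment :: "real \<Rightarrow> real \<Rightarrow> real set" where
  "Qsegment x y = {q * x + (1 - q) * y | q. q \<in> \<rat> \<inter> {0..1}}"

text \<open>The function \<open>g\<close> below stands for a function on the closed interval from \<open>y\<close> to \<open>z\<close>;
  its values outside that interval are irrelevant.\<close>

definition Qsegment_extendable :: "(real \<Rightarrow> real) \<Rightarrow> real \<Rightarrow> real \<Rightarrow> bool" where
  "Qsegment_extendable f y z \<longleftrightarrow>
     (\<exists>g :: real \<Rightarrow> real. continuous_on {y..z} g \<and> (\<forall>t \<in> Qsegment y z. g t = f t))"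

definition Q_continuous_left_at :: "(real \<Rightarrow> real) \<Rightarrow> real \<Rightarrow> bool" where
  "Q_continuous_left_at f x \<longleftrightarrow>
     (\<exists>\<epsilon>>0. \<forall>y z. x - \<epsilon> < y \<and> y < z \<and> z \<le> x \<longrightarrow> Qsegment_extendable f y z)"

definition Q_continuous_right_at :: "(real \<Rightarrow> real) \<Rightarrow> real \<Rightarrow> bool" where
  "Q_continuous_right_at f x \<longleftrightarrow>
     (\<exists>\<epsilon>>0. \<forall>y z. x \<le> y \<and> y < z \<and> z < x + \<epsilon> \<longrightarrow> Qsegment_extendable f y z)"

definition Q_continuous_at :: "(real \<Rightarrow> real) \<Rightarrow> real \<Rightarrow> bool" where
  "Q_continuous_at f x \<longleftrightarrow> Q_continuous_left_at f x \<and> Q_continuous_right_at f x"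

definition Q_continuous :: "(real \<Rightarrow> real) \<Rightarrow> bool" where
  "Q_continuous f \<longleftrightarrow> (\<forall>x. Q_continuous_at f x)"

definition bilaterally_Q_continuous_at :: "(real \<Rightarrow> real) \<Rightarrow> real \<Rightarrow> bool" where
  "bilaterally_Q_continuous_at f x \<longleftrightarrow>
     (\<exists>\<epsilon>>0. \<forall>y z. x - \<epsilon> \<le> y \<and> y < z \<and> z \<le> x + \<epsilon> \<longrightarrow> Qsegment_extendable f y z)"

definition bilaterally_Q_continuous :: "(real \<Rightarrow> real) \<Rightarrow> bool" where
  "bilaterally_Q_continuous f \<longleftrightarrow> (\<forall>x. bilaterally_Q_continuous_at f x)"

definition discontinuities :: "(real \<Rightarrow> real) \<Rightarrow> real set" where
  "discontinuities g = {z. \<not> isCont g z}"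

end

theory Submission
  imports Defs
begin

text \<open>
  The set \<^term>\<open>Qline x y\<close> is a dense affine copy of the rationals, and any two of its points
  \<open>a < b\<close> generate it again: \<open>Qsegment a b\<close> is exactly the part of \<open>Qline x y\<close> between \<open>a\<close> and \<open>b\<close>
  (\<open>Qline_between_subset_Qsegment\<close>). Extendability of \<open>f\<close> from a rational segment is therefore the
  same as a continuous extension of the restriction of \<open>f\<close> to a piece of \<open>Qline x y\<close>. By density such
  an extension is unique: its value at \<open>t\<close> has to be the limit of \<open>f\<close> at \<open>t\<close> along \<open>Qline x y\<close>.
  Hence the local extensions glue, and one formula, \<open>limit_along\<close>, provides the global function
  \<open>G\<close> in both equivalences; it is continuous at every point around which \<open>f\<close> extends
  (\<open>isCont_limit_along\<close>).

  Bilateral \<open>\<rat>\<close>-continuity says that \<open>f\<close> extends around every point, so \<open>G\<close> is continuous. Under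
  \<open>\<rat>\<close>-continuity at \<open>p\<close>, with a radius \<open>\<epsilon>\<close> good for both sides, \<open>f\<close> extends around every point
  of the punctured \<open>\<epsilon>\<close>-neighbourhood of \<open>p\<close>, along every rational line. As \<open>\<epsilon>\<close> does not depend on the
  line, only \<open>p\<close> itself can be a discontinuity there of any of the functions \<open>G\<close>, so discontinuities
  do not accumulate. When \<open>p\<close> lies on the line, the extensions on the left and on the right of \<open>p\<close>
  both take the value \<open>f p\<close> at \<open>p\<close> and fit together, which removes the discontinuity.

  Conversely, the function \<open>G\<close> for the line through \<open>y\<close> and \<open>z\<close> can be restricted to the interval
  between them. Near \<open>p\<close> there is no discontinuity other than possibly \<open>p\<close>, and \<open>p\<close> is not interior to
  a segment lying on one side of it. So continuity could only fail at \<open>p\<close> as an endpoint; but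
  endpoints lie on the line, where \<open>G\<close> is continuous.
\<close>

section \<open>Rational lines\<close>

lemma endpoints_in_Qline: "x \<in> Qline x y" "y \<in> Qline x y"
proof -
  have "x = 1 * x + (1 - 1) * y" "y = 0 * x + (1 - 0) * y" by simp_all
  then show "x \<in> Qline x y" "y \<in> Qline x y"
    unfolding Qline_def using Rats_0 Rats_1 by blast+
qed

lemma Qsegment_subset_Qline: "Qsegment x y \<subseteq> Qline x y"
  unfolding Qsegment_def Qline_def by blast

lemma Qline_dense:
  assumes "x < y" "a < b"
  shows "\<exists>s \<in> Qline x y. a < s \<and> s < b"
proof -
  have "(y - b) / (y - x) < (y - a) / (y - x)"
    using assms by (simp add: divide_strict_right_mono)
  then obtain q where "q \<in> \<rat>" "(y - b) / (y - x) < q" "q < (y - a) / (y - x)"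
    using Rats_dense_in_real by blast
  moreover from this have "y - b < q * (y - x)" "q * (y - x) < y - a"
    using assms by (simp_all add: pos_divide_less_eq pos_less_divide_eq)
  then have "a < q * x + (1 - q) * y" "q * x + (1 - q) * y < b"
    by (simp_all add: algebra_simps)
  ultimately show ?thesis unfolding Qline_def by blast
qed

text \<open>The affine parameter of a point of the line with respect to the new base points \<open>a\<close> and \<open>b\<close> is a
  quotient of differences of rational parameters, hence rational again.\<close>

lemma Qline_between_subset_Qsegment:
  assumes "x < y" "a \<in> Qline x y" "b \<in> Qline x y" "a < b"
  shows "Qline x y \<inter> {a..b} \<subseteq> Qsegment a b"
proof
  fix t assume t: "t \<in> Qline x y \<inter> {a..b}"
  obtain p q r where rat: "p \<in> \<rat>" "q \<in> \<rat>" "r \<in> \<rat>"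
    and eq: "a = p * x + (1 - p) * y" "b = q * x + (1 - q) * y" "t = r * x + (1 - r) * y"
    using assms t by (auto simp: Qline_def)
  define u where "u = (r - q) / (p - q)"
  have ba: "b - a = (p - q) * (y - x)" and bt: "b - t = (r - q) * (y - x)"
    by (simp_all add: eq algebra_simps)
  have "u = (b - t) / (b - a)"
    unfolding ba bt u_def using \<open>x < y\<close> by simp
  then have "u \<in> {0..1}" "u * (b - a) = b - t"
    using t \<open>a < b\<close> by (simp_all add: divide_le_eq_1)
  then have "u \<in> {0..1}" "t = u * a + (1 - u) * b"
    by (simp_all add: algebra_simps)
  moreover have "u \<in> \<rat>" unfolding u_def using rat by simp
  ultimately show "t \<in> Qsegment a b" unfolding Qsegment_def by blast
qed

section \<open>Extension along a dense set\<close>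

definition extends_around :: "(real \<Rightarrow> real) \<Rightarrow> real set \<Rightarrow> real \<Rightarrow> bool" where
  "extends_around f L p \<longleftrightarrow>
     (\<exists>a b g. a < p \<and> p < b \<and> continuous_on {a..b} g \<and> (\<forall>t \<in> L \<inter> {a..b}. g t = f t))"

text \<open>Where the limit does not exist, the value is arbitrary; such points may become discontinuities.\<close>

definition limit_along :: "real set \<Rightarrow> (real \<Rightarrow> real) \<Rightarrow> real \<Rightarrow> real" where
  "limit_along L f t = Lim (at t within L) f"

lemma limit_along_eq_extension:
  assumes dense: "\<And>a b. a < b \<Longrightarrow> \<exists>s \<in> L. a < s \<and> s < b"
    and g: "continuous_on {a..b} g" "\<forall>t \<in> L \<inter> {a..b}. g t = f t"
    and t: "a < t" "t < b"
  shows "limit_along L f t = g t"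
proof -
  have "t islimpt L"
  proof (rule islimptI)
    fix T assume "t \<in> T" "open T"
    then obtain e where e: "e > 0" "ball t e \<subseteq> T" using open_contains_ball by blast
    obtain s where "s \<in> L" "t < s" "s < t + e" using dense[of t "t + e"] e by auto
    moreover from this have "s \<in> T" using e by (auto simp: dist_real_def)
    ultimately show "\<exists>s \<in> L. s \<in> T \<and> s \<noteq> t" by auto
  qed
  then have nontriv: "at t within L \<noteq> bot" by (simp add: trivial_limit_within)
  have "isCont g t"
    using g(1) t by (intro continuous_on_interior[of "{a..b}"]) auto
  then have "(g \<longlongrightarrow> g t) (at t within L)"
    by (simp add: isCont_def filterlim_mono at_le)
  moreover have "\<forall>\<^sub>F s in at t within L. g s = f s"
    unfolding eventually_at_topological using g(2) t
    by (intro exI[of _ "{a<..<b}"]) auto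
  ultimately have "(f \<longlongrightarrow> g t) (at t within L)"
    by (rule Lim_transform_eventually)
  then show ?thesis
    unfolding limit_along_def using nontriv by (rule tendsto_Lim[rotated])
qed

lemma isCont_limit_along:
  assumes dense: "\<And>a b. a < b \<Longrightarrow> \<exists>s \<in> L. a < s \<and> s < b"
    and "extends_around f L p"
  shows "isCont (limit_along L f) p"
proof -
  obtain a b g where ab: "a < p" "p < b" and g: "continuous_on {a..b} g"
    "\<forall>t \<in> L \<inter> {a..b}. g t = f t"
    using assms(2) unfolding extends_around_def by blast
  have "isCont g p"
    using g(1) ab by (intro continuous_on_interior[of "{a..b}"]) auto
  moreover have "\<forall>\<^sub>F t in nhds p. limit_along L f t = g t"
    unfolding eventually_nhds using limit_along_eq_extension[OF dense g] ab
    by (intro exI[of _ "{a<..<b}"]) auto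
  ultimately show ?thesis by (simp add: isCont_cong)
qed

lemma limit_along_eq:
  assumes dense: "\<And>a b. a < b \<Longrightarrow> \<exists>s \<in> L. a < s \<and> s < b"
    and "extends_around f L p" "p \<in> L"
  shows "limit_along L f p = f p"
proof -
  obtain a b g where ab: "a < p" "p < b" and g: "continuous_on {a..b} g"
    "\<forall>t \<in> L \<inter> {a..b}. g t = f t"
    using assms(2) unfolding extends_around_def by blast
  then show ?thesis
    using limit_along_eq_extension[OF dense g ab] \<open>p \<in> L\<close> by simp
qed

section \<open>From rational segments to lines\<close>

lemma Qsegment_extendable_on_Qline:
  assumes "x < y" "a \<in> Qline x y" "b \<in> Qline x y" "a < b" "Qsegment_extendable f a b"
  obtains g where "continuous_on {a..b} g" "\<forall>t \<in> Qline x y \<inter> {a..b}. g t = f t"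
  using assms Qline_between_subset_Qsegment[OF assms(1-4)]
  unfolding Qsegment_extendable_def by blast

lemma extends_around_inside:
  assumes "x < y" "c < p" "p < d"
    and ext: "\<And>a b. c < a \<Longrightarrow> a < b \<Longrightarrow> b < d \<Longrightarrow> Qsegment_extendable f a b"
  shows "extends_around f (Qline x y) p"
proof -
  obtain a where a: "a \<in> Qline x y" "c < a" "a < p" using Qline_dense assms by blast
  obtain b where b: "b \<in> Qline x y" "p < b" "b < d" using Qline_dense assms by blast
  obtain g where "continuous_on {a..b} g" "\<forall>t \<in> Qline x y \<inter> {a..b}. g t = f t"
    using Qsegment_extendable_on_Qline[of x y a b f] assms(1) ext a b by auto
  then show ?thesis unfolding extends_around_def using a b by blast
qed

text \<open>At a point \<open>p\<close> of the line itself, one-sided information is enough: both one-sided extensions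
  include \<open>p\<close> in their domain and are equal to \<open>f p\<close> there, so they can be pasted.\<close>

lemma extends_around_point_of_Qline:
  assumes "x < y" "p \<in> Qline x y" "c < p" "p < d"
    and left: "\<And>a. c < a \<Longrightarrow> a < p \<Longrightarrow> Qsegment_extendable f a p"
    and right: "\<And>b. p < b \<Longrightarrow> b < d \<Longrightarrow> Qsegment_extendable f p b"
  shows "extends_around f (Qline x y) p"
proof -
  let ?L = "Qline x y"
  obtain a where a: "a \<in> ?L" "c < a" "a < p" using Qline_dense assms by blast
  obtain b where b: "b \<in> ?L" "p < b" "b < d" using Qline_dense assms by blast
  obtain g where g: "continuous_on {a..p} g" "\<forall>t \<in> ?L \<inter> {a..p}. g t = f t"
    using Qsegment_extendable_on_Qline[of x y a p f] assms a by auto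
  obtain h where h: "continuous_on {p..b} h" "\<forall>t \<in> ?L \<inter> {p..b}. h t = f t"
    using Qsegment_extendable_on_Qline[of x y p b f] assms b by auto
  define k where "k t = (if t \<le> p then g t else h t)" for t
  have "g p = h p" using g(2) h(2) a b assms(2) by simp
  then have "continuous_on ({a..p} \<union> {p..b}) k"
    unfolding k_def using g(1) h(1) by (intro continuous_on_If) auto
  then have "continuous_on {a..b} k" using a b by (simp add: ivl_disj_un_two_touch)
  moreover have "\<forall>t \<in> ?L \<inter> {a..b}. k t = f t" using g(2) h(2) by (auto simp: k_def)
  ultimately show ?thesis unfolding extends_around_def using a b by blast
qed

lemma Qsegment_extendable_restrict:
  assumes "y < z" "\<And>t. t \<in> {y..z} \<Longrightarrow> isCont g t" "\<And>t. t \<in> Qline y z \<Longrightarrow> g t = f t"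
  shows "Qsegment_extendable f y z"
  unfolding Qsegment_extendable_def
  using assms Qsegment_subset_Qline continuous_at_imp_continuous_on[of "{y..z}" g] by blast

section \<open>The two equivalences\<close>

lemma bilaterally_Q_continuous_iff:
  "bilaterally_Q_continuous f \<longleftrightarrow>
     (\<forall>x y. x < y \<longrightarrow> (\<exists>G. continuous_on UNIV G \<and> (\<forall>t \<in> Qline x y. G t = f t)))"
  (is "?lhs \<longleftrightarrow> ?rhs")
proof
  assume lhs: ?lhs
  show ?rhs
  proof (intro allI impI)
    fix x y :: real assume xy: "x < y"
    have ext: "extends_around f (Qline x y) p" for p
    proof -
      obtain e where "e > 0"
        "\<forall>y z. p - e \<le> y \<and> y < z \<and> z \<le> p + e \<longrightarrow> Qsegment_extendable f y z"
        using lhs unfolding bilaterally_Q_continuous_def bilaterally_Q_continuous_at_def by blast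
      then show ?thesis
        using extends_around_inside[OF xy, of "p - e" p "p + e" f] by auto
    qed
    let ?G = "limit_along (Qline x y) f"
    have "continuous_on UNIV ?G"
      using isCont_limit_along[OF Qline_dense[OF xy] ext]
      by (simp add: continuous_at_imp_continuous_on)
    moreover have "\<forall>t \<in> Qline x y. ?G t = f t"
      using limit_along_eq[OF Qline_dense[OF xy] ext] by blast
    ultimately show "\<exists>G. continuous_on UNIV G \<and> (\<forall>t \<in> Qline x y. G t = f t)" by blast
  qed
next
  assume rhs: ?rhs
  have "Qsegment_extendable f y z" if yz: "y < z" for y z
  proof -
    obtain G where "continuous_on UNIV G" "\<forall>t \<in> Qline y z. G t = f t"
      using rhs yz by blast
    then show ?thesis
      using Qsegment_extendable_restrict[OF yz, of G f] by (simp add: continuous_on_eq_continuous_at)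
  qed
  then show ?lhs
    unfolding bilaterally_Q_continuous_def bilaterally_Q_continuous_at_def
    by (auto intro: exI[of _ 1])
qed

text \<open>The radius \<open>\<epsilon>\<close> serves all rational lines at once; this uniformity is what keeps the union of
  the discontinuity sets from accumulating.\<close>

lemma Q_continuous_at_imp_extends_around:
  assumes "Q_continuous_at f p"
  obtains \<epsilon> where "\<epsilon> > 0"
    "\<And>x y t. x < y \<Longrightarrow> \<bar>t - p\<bar> < \<epsilon> \<Longrightarrow> t \<noteq> p \<or> p \<in> Qline x y \<Longrightarrow> extends_around f (Qline x y) t"
proof -
  obtain d where d: "d > 0"
    "\<And>y z. p - d < y \<Longrightarrow> y < z \<Longrightarrow> z \<le> p \<Longrightarrow> Qsegment_extendable f y z"
    using assms unfolding Q_continuous_at_def Q_continuous_left_at_def by blast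
  obtain e where e: "e > 0"
    "\<And>y z. p \<le> y \<Longrightarrow> y < z \<Longrightarrow> z < p + e \<Longrightarrow> Qsegment_extendable f y z"
    using assms unfolding Q_continuous_at_def Q_continuous_right_at_def by blast
  show thesis
  proof (rule that[of "min d e"])
    show "min d e > 0" using d e by simp
    fix x y t :: real
    assume xy: "x < y" and t: "\<bar>t - p\<bar> < min d e" "t \<noteq> p \<or> p \<in> Qline x y"
    consider "t < p" | "p < t" | "t = p" by linarith
    then show "extends_around f (Qline x y) t"
    proof cases
      case 1
      then show ?thesis using extends_around_inside[OF xy, of "p - d" t p f] d t by auto
    next
      case 2
      then show ?thesis using extends_around_inside[OF xy, of p t "p + e" f] e t by auto
    next
      case 3
      then show ?thesis
        using extends_around_point_of_Qline[OF xy, of p "p - d" "p + e" f] d e t by auto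
    qed
  qed
qed

lemma Q_continuous_iff:
  "Q_continuous f \<longleftrightarrow>
     (\<exists>G :: real \<Rightarrow> real \<Rightarrow> real \<Rightarrow> real.
        (\<forall>x y. x < y \<longrightarrow> (\<forall>t \<in> Qline x y. G x y t = f t))
      \<and> (\<forall>x y. x < y \<longrightarrow> discontinuities (G x y) \<inter> Qline x y = {})
      \<and> \<not> (\<exists>a :: real. a islimpt {z. \<exists>x y. x < y \<and> z \<in> discontinuities (G x y)}))"
  (is "?lhs \<longleftrightarrow> ?rhs")
proof
  assume lhs: ?lhs
  define G where "G x y = limit_along (Qline x y) f" for x y
  have on_line: "extends_around f (Qline x y) t" if "x < y" "t \<in> Qline x y" for x y t
  proof -
    have "Q_continuous_at f t" using lhs by (simp add: Q_continuous_def)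
    from Q_continuous_at_imp_extends_around[OF this] show ?thesis
      using that by (metis abs_zero diff_self)
  qed
  have "\<forall>x y. x < y \<longrightarrow> (\<forall>t \<in> Qline x y. G x y t = f t)"
    unfolding G_def using limit_along_eq Qline_dense on_line by blast
  moreover have "\<forall>x y. x < y \<longrightarrow> discontinuities (G x y) \<inter> Qline x y = {}"
    unfolding G_def discontinuities_def using isCont_limit_along Qline_dense on_line by blast
  moreover have "\<not> p islimpt {z. \<exists>x y. x < y \<and> z \<in> discontinuities (G x y)}" for p
  proof -
    have "Q_continuous_at f p" using lhs by (simp add: Q_continuous_def)
    then obtain e where e: "e > 0"
      "\<And>x y t. x < y \<Longrightarrow> \<bar>t - p\<bar> < e \<Longrightarrow> t \<noteq> p \<or> p \<in> Qline x y
         \<Longrightarrow> extends_around f (Qline x y) t"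
      using Q_continuous_at_imp_extends_around by metis
    have "isCont (G x y) t" if "x < y" "\<bar>t - p\<bar> < e" "t \<noteq> p" for x y t
      unfolding G_def using isCont_limit_along Qline_dense e(2) that by blast
    then show ?thesis
      unfolding islimpt_approachable discontinuities_def dist_real_def using \<open>e > 0\<close> by blast
  qed
  ultimately show ?rhs by blast
next
  assume ?rhs
  then obtain G :: "real \<Rightarrow> real \<Rightarrow> real \<Rightarrow> real"
    where G: "\<And>x y t. x < y \<Longrightarrow> t \<in> Qline x y \<Longrightarrow> G x y t = f t"
      and on_line: "\<And>x y t. x < y \<Longrightarrow> t \<in> Qline x y \<Longrightarrow> isCont (G x y) t"
      and isolated: "\<And>a. \<not> a islimpt {z. \<exists>x y. x < y \<and> z \<in> discontinuities (G x y)}"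
    unfolding discontinuities_def by blast
  have "Q_continuous_at f p" for p
  proof -
    obtain e where "e > 0"
      and e: "\<And>x y t. x < y \<Longrightarrow> \<bar>t - p\<bar> < e \<Longrightarrow> t \<noteq> p \<Longrightarrow> isCont (G x y) t"
      using isolated[of p]
      unfolding islimpt_approachable discontinuities_def dist_real_def by blast
    have "Qsegment_extendable f y z"
      if yz: "y < z" "p - e < y" "z < p + e" and p: "z \<le> p \<or> p \<le> y" for y z
    proof (rule Qsegment_extendable_restrict[OF yz(1)])
      fix t assume t: "t \<in> {y..z}"
      \<comment> \<open>If \<open>t = p\<close>, then \<open>t\<close> is an endpoint of the segment, since \<open>p\<close> is not interior to it.\<close>
      show "isCont (G y z) t"
        using e[of y z t] on_line[of y z t] endpoints_in_Qline[where x = y and y = z]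
          yz p t by (cases "t = p") (auto simp: abs_less_iff)
    qed (use G yz in auto)
    then show ?thesis
      unfolding Q_continuous_at_def Q_continuous_left_at_def Q_continuous_right_at_def
      using \<open>e > 0\<close> by (auto intro!: exI[of _ e])
  qed
  then show ?lhs by (simp add: Q_continuous_def)
qed

theorem theorem8p2:
  fixes f :: "real \<Rightarrow> real"
  shows "(bilaterally_Q_continuous f \<longleftrightarrow>
            (\<forall>x y. x < y \<longrightarrow>
               (\<exists>G :: real \<Rightarrow> real. continuous_on UNIV G \<and> (\<forall>t \<in> Qline x y. G t = f t))))
       \<and> (Q_continuous f \<longleftrightarrow>
            (\<exists>G :: real \<Rightarrow> real \<Rightarrow> real \<Rightarrow> real.
               (\<forall>x y. x < y \<longrightarrow> (\<forall>t \<in> Qline x y. G x y t = f t))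
             \<and> (\<forall>x y. x < y \<longrightarrow> discontinuities (G x y) \<inter> Qline x y = {})
             \<and> \<not> (\<exists>a :: real. a islimpt {z. \<exists>x y. x < y \<and> z \<in> discontinuities (G x y)})))"
  using bilaterally_Q_continuous_iff Q_continuous_iff by (rule conjI)

end
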